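(* Let $(P)$ be a continuous problem and let $\widehat{x}\in S$ be such that all constraint functions $g_t$, $t\in T$, are continuously differentiable around $\widehat{x}$ and the Mangasarian–Fromovitz constraint qualification (MFCQ) holds at $\widehat{x}$. Then $\widehat{x}$ is an isolated efficient solution of $(P)$ if and only if there exists $\nu>0$ such that for all $w\in\nu\mathbb{B}_n$ there exist $\xi=(\xi_1,\ldots,\xi_p)\in\prod_{i=1}^{p}\partial f_i(\widehat{x})$ and $\lambda\geq0_p$ such that $\vartheta(\widehat{x},\xi-w,\lambda)=0$, where $\xi-w:=(\xi_1-w,\ldots,\xi_p-w)$.
   Context: Setting: $p\geq 2$, $I:=\{1,\ldots,p\}$; $f_i:\mathbb{R}^n\to\mathbb{R}$ ($i\in I$) are finite-valued convex functions; $T$ is an infinite index set; for each $t\in T$, $g_t:\mathbb{R}^n\to\mathbb{R}\cup\{+\infty\}$ is a lower semicontinuous proper convex function. Problem $(P)$: minimize $f(x):=(f_1(x),\ldots,f_p(x))$ subject to $g_t(x)\le 0$, $t\in T$, with feasible set $S:=\{x\in\mathbb{R}^n\mid g_t(x)\le 0\ \forall t\in T\}$ assumed nonempty. $(P)$ is called continuous when $T$ is a compact Hausdorff topological space and $(t,x)\mapsto g_t(x)$ is (finite-valued and) continuous on $T\times\mathbb{R}^n$. $\widehat{x}\in S$ is an isolated efficient solution of $(P)$ if there is a constant $\nu>0$ such that $\max_{i\in I}\{f_i(x)-f_i(\widehat{x})\}\ge\nu\|x-\widehat{x}\|$ for all $x\in S$ (Euclidean norm). For $\lambda\in\mathbb{R}^p$,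 $\lambda\geq0_p$ means $\lambda_i\ge0$ for all $i\in I$ and $\lambda\neq0_p$. For $x\in\mathbb{R}^n$, $\eta=(\eta_1,\ldots,\eta_p)\in(\mathbb{R}^n)^p$ and such $\lambda$, the gap function is $$\vartheta(x,\eta,\lambda):=\sup_{y\in S}\Big\{\sum_{i=1}^{p}\lambda_i\,\eta_i'(x-y)\Big\}\in[-\infty,+\infty].$$ Notation: $\mathbb{B}_n$ is the closed Euclidean unit ball; $\partial$ is the Fenchel–Moreau subdifferential; $T(\widehat{x}):=\{t\in T\mid g_t(\widehat{x})=0\}$; $G(\widehat{x}):=\bigcup_{t\in T(\widehat{x})}\partial g_t(\widehat{x})$; $G^{-}(\widehat{x}):=\{d\in\mathbb{R}^n\mid\xi'd<0\ \forall\xi\in G(\widehat{x})\}$. MFCQ holds at $\widehat{x}$ if $G(\widehat{x})\ne\emptyset$ and $G^{-}(\widehat{x})\neq\emptyset$. *)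

theory Defs
  imports "HOL-Analysis.Analysis"
begin

text \<open>
  The constraint functions are real-valued: in a continuous problem \<open>(t, x) \<mapsto> g\<^sub>t(x)\<close> is finite
  and continuous, so properness and lower semicontinuity of each \<open>g\<^sub>t\<close> are automatic.
\<close>

definition feasible_set :: "'t set \<Rightarrow> ('t \<Rightarrow> real ^ 'n \<Rightarrow> real) \<Rightarrow> (real ^ 'n) set" where
  "feasible_set T g = {x. \<forall>t\<in>T. g t x \<le> 0}"

definition isolated_efficient ::
    "('p::finite \<Rightarrow> real ^ 'n \<Rightarrow> real) \<Rightarrow> (real ^ 'n) set \<Rightarrow> real ^ 'n \<Rightarrow> bool" where
  "isolated_efficient f S xh \<longleftrightarrow>
     xh \<in> S \<and> (\<exists>\<nu>>0. \<forall>x\<in>S. (MAX i. f i x - f i xh) \<ge> \<nu> * norm (x - xh))"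

definition subdifferential :: "(real ^ 'n \<Rightarrow> real) \<Rightarrow> real ^ 'n \<Rightarrow> (real ^ 'n) set" where
  "subdifferential h x = {\<xi>. \<forall>y. h y \<ge> h x + \<xi> \<bullet> (y - x)}"

definition gap_function ::
    "(real ^ 'n) set \<Rightarrow> real ^ 'n \<Rightarrow> (real ^ 'n) ^ 'p \<Rightarrow> real ^ 'p \<Rightarrow> ereal" where
  "gap_function S x \<eta> l = (SUP y\<in>S. ereal (\<Sum>i\<in>UNIV. l $ i * (\<eta> $ i \<bullet> (x - y))))"

definition semipositive :: "real ^ 'p \<Rightarrow> bool" where
  "semipositive l \<longleftrightarrow> (\<forall>i. l $ i \<ge> 0) \<and> l \<noteq> 0"

definition active_indices :: "'t set \<Rightarrow> ('t \<Rightarrow> real ^ 'n \<Rightarrow> real) \<Rightarrow> real ^ 'n \<Rightarrow> 't set" where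
  "active_indices T g x = {t \<in> T. g t x = 0}"

definition active_subgradients ::
    "'t set \<Rightarrow> ('t \<Rightarrow> real ^ 'n \<Rightarrow> real) \<Rightarrow> real ^ 'n \<Rightarrow> (real ^ 'n) set" where
  "active_subgradients T g x = (\<Union>t\<in>active_indices T g x. subdifferential (g t) x)"

definition strict_polar :: "(real ^ 'n) set \<Rightarrow> (real ^ 'n) set" where
  "strict_polar G = {d. \<forall>\<xi>\<in>G. \<xi> \<bullet> d < 0}"

definition MFCQ :: "'t set \<Rightarrow> ('t \<Rightarrow> real ^ 'n \<Rightarrow> real) \<Rightarrow> real ^ 'n \<Rightarrow> bool" where
  "MFCQ T g x \<longleftrightarrow>
     active_subgradients T g x \<noteq> {} \<and> strict_polar (active_subgradients T g x) \<noteq> {}"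

definition continuously_differentiable_around :: "(real ^ 'n \<Rightarrow> real) \<Rightarrow> real ^ 'n \<Rightarrow> bool" where
  "continuously_differentiable_around h x \<longleftrightarrow>
     (\<exists>U D. open U \<and> x \<in> U \<and> (\<forall>y\<in>U. GDERIV h y :> D y) \<and> continuous_on U D)"

end

theory Submission imports Defs begin

text \<open>
  Since the point \<open>y = xh\<close> is admissible in the supremum, the gap function is nonnegative, and it
  vanishes exactly when \<open>(\<Sum>i. l i *\<^sub>R (\<xi> i - w)) \<bullet> (y - xh) \<ge> 0\<close> for all \<open>y \<in> S\<close>. This is a
  linearised multiplier rule for the objectives tilted by the linear form \<open>w\<close>, and it
  characterises those tilts whose increments from \<open>xh\<close> have a nonnegative maximum on \<open>S\<close>. Isolated
  efficiency with constant \<open>\<nu>\<close> is the same as this nonnegativity for all tilts with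
  \<open>norm w \<le> \<nu>\<close>, because \<open>\<nu> * norm (x - xh)\<close> is the largest value of \<open>w \<bullet> (x - xh)\<close> over
  these \<open>w\<close>.

  Sufficiency: given \<open>x \<in> S\<close>, tilt in the direction of \<open>x - xh\<close>, with \<open>w\<close> of norm \<open>\<nu>\<close>. Then
  \<open>w \<bullet> (x - xh) = \<nu> * norm (x - xh)\<close>, the subgradient inequalities bound the weighted sum of the
  increments \<open>f i x - f i xh\<close> below by \<open>(\<Sum>i. l i) * \<nu> * norm (x - xh)\<close>, and a weighted average
  never exceeds the maximum (\<open>Max_ge_of_weighted_sum\<close>).

  Necessity: by Cauchy-Schwarz, the tilted increments
  \<open>F i x = f i x - f i xh - w \<bullet> (x - xh)\<close> have a nonnegative maximum at every point of the convex
  set \<open>S\<close>. Both the weights and the subgradients come from one single separation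
  (\<open>decoupled_multipliers\<close>): each \<open>F i\<close> gets its own copy \<open>y i\<close> of the variable, and the
  origin is separated from the set of all pairs of a mismatch vector \<open>(y i - s)\<close>, with \<open>s \<in> S\<close>, and
  a vector lying strictly above \<open>(F i (y i))\<close>. The functional found on the second component is the
  weight vector, and on the first component it consists of the scaled subgradients; freeing the
  copies from each other is what replaces the sum rule for subdifferentials. A component of weight
  zero carries no subgradient, and there an arbitrary one is inserted
  (\<open>subdifferential_nonempty\<close>).
\<close>

section \<open>Multipliers for families of convex functions\<close>

text \<open>
  A common zero of all mismatches \<open>y i - s\<close> forces \<open>y i = s \<in> S\<close>, where some \<open>F i\<close> is nonnegative;
  so the origin is not in the set being separated. The weights are nonnegative because
  the second component is unbounded above. They are not all zero because the copies \<open>y i\<close>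
  range over the whole space: a functional depending on the mismatches alone would be a linear form
  bounded below on the whole space and hence vanish.
\<close>

lemma decoupled_multipliers:
  fixes F :: "'p::finite \<Rightarrow> 'a::euclidean_space \<Rightarrow> real"
  assumes conv: "\<And>i. convex_on UNIV (F i)" and "convex S" and "S \<noteq> {}"
    and nonneg: "\<And>s. s \<in> S \<Longrightarrow> \<exists>i. 0 \<le> F i s"
  obtains l :: "real ^ 'p" and a :: "'p \<Rightarrow> 'a"
  where "semipositive l"
    and "\<And>s y. s \<in> S \<Longrightarrow> (\<Sum>i\<in>UNIV. a i \<bullet> (y i - s)) \<le> (\<Sum>i\<in>UNIV. l $ i * F i (y i))"
proof -
  define B :: "(('a ^ 'p) \<times> (real ^ 'p)) set"
    where "B = {(d, z). \<exists>s\<in>S. \<forall>i. F i (s + d $ i) < z $ i}"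
  have "convex B"
    unfolding convex_alt
  proof (intro ballI allI impI)
    fix b c :: "('a ^ 'p) \<times> (real ^ 'p)" and u :: real
    assume "b \<in> B" "c \<in> B" and u: "0 \<le> u \<and> u \<le> 1"
    then obtain d z s d' z' s'
      where b: "b = (d, z)" "s \<in> S" "\<And>i. F i (s + d $ i) < z $ i"
        and c: "c = (d', z')" "s' \<in> S" "\<And>i. F i (s' + d' $ i) < z' $ i"
      unfolding B_def by blast
    define r where "r = (1 - u) *\<^sub>R s + u *\<^sub>R s'"
    have "r \<in> S"
      using \<open>convex S\<close> b(2) c(2) u unfolding r_def convex_alt by blast
    moreover have "F i (r + ((1 - u) *\<^sub>R d + u *\<^sub>R d') $ i) < ((1 - u) *\<^sub>R z + u *\<^sub>R z') $ i" for i
    proof -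
      have "r + ((1 - u) *\<^sub>R d + u *\<^sub>R d') $ i
          = (1 - u) *\<^sub>R (s + d $ i) + u *\<^sub>R (s' + d' $ i)"
        by (simp add: r_def algebra_simps)
      then have "F i (r + ((1 - u) *\<^sub>R d + u *\<^sub>R d') $ i)
          \<le> (1 - u) * F i (s + d $ i) + u * F i (s' + d' $ i)"
        using convex_onD[OF conv[of i], of u "s + d $ i" "s' + d' $ i"] u by simp
      also have "\<dots> < (1 - u) * z $ i + u * z' $ i"
      proof (cases "u = 0")
        case False
        then show ?thesis
          using u b(3)[of i] c(3)[of i] by (intro add_le_less_mono mult_left_mono) auto
      qed (use b(3) in simp)
      finally show ?thesis by simp
    qed
    ultimately show "(1 - u) *\<^sub>R b + u *\<^sub>R c \<in> B"
      unfolding B_def b(1) c(1) by auto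
  qed
  moreover have "0 \<notin> B"
  proof
    assume "0 \<in> B"
    then obtain s where "s \<in> S" "\<And>i. F i s < 0"
      by (auto simp: B_def zero_prod_def)
    with nonneg[OF \<open>s \<in> S\<close>] show False
      by (meson not_less)
  qed
  ultimately have "\<exists>q. q \<noteq> 0 \<and> (\<forall>b\<in>B. 0 \<le> q \<bullet> b)"
    by (rule separating_hyperplane_set_0)
  then obtain q where "q \<noteq> 0" and q: "\<And>b. b \<in> B \<Longrightarrow> 0 \<le> q \<bullet> b"
    by blast
  obtain v l where vl: "q = (v, l)" by (cases q)
  have strict: "0 \<le> (\<Sum>i\<in>UNIV. v $ i \<bullet> (y i - s)) + (\<Sum>i\<in>UNIV. l $ i * z i)"
    if "s \<in> S" "\<And>i. F i (y i) < z i" for s y z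
  proof -
    have "((\<chi> i. y i - s), (\<chi> i. z i)) \<in> B"
      using that by (auto simp: B_def intro!: bexI[of _ s])
    from q[OF this] show ?thesis
      by (simp add: vl inner_vec_def)
  qed
  \<comment> \<open>Passing to the limit in the second component makes the strict inequality weak.\<close>
  have main: "0 \<le> (\<Sum>i\<in>UNIV. v $ i \<bullet> (y i - s)) + (\<Sum>i\<in>UNIV. l $ i * F i (y i))"
    if "s \<in> S" for s y
  proof (rule tendsto_lowerbound)
    show "((\<lambda>e. (\<Sum>i\<in>UNIV. v $ i \<bullet> (y i - s)) + (\<Sum>i\<in>UNIV. l $ i * (F i (y i) + e)))
        \<longlongrightarrow> (\<Sum>i\<in>UNIV. v $ i \<bullet> (y i - s)) + (\<Sum>i\<in>UNIV. l $ i * F i (y i))) (at_right 0)"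
      by (auto intro!: tendsto_eq_intros)
    show "\<forall>\<^sub>F e in at_right 0.
        0 \<le> (\<Sum>i\<in>UNIV. v $ i \<bullet> (y i - s)) + (\<Sum>i\<in>UNIV. l $ i * (F i (y i) + e))"
      using strict[OF that] by (auto simp: eventually_at_right_field intro: exI[of _ 1])
  qed simp
  obtain s0 where "s0 \<in> S" using \<open>S \<noteq> {}\<close> by blast
  have l_nonneg: "0 \<le> l $ j" for j
  proof (rule ccontr)
    assume "\<not> 0 \<le> l $ j"
    define A where "A = (\<Sum>i\<in>UNIV. l $ i * (F i s0 + 1))"
    \<comment> \<open>Raising component \<open>j\<close> by \<open>t\<close> lowers the functional by \<open>\<bar>A\<bar> + 1\<close>, which makes it negative.\<close>
    define t where "t = (\<bar>A\<bar> + 1) / - l $ j"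
    have "0 \<le> t" using \<open>\<not> 0 \<le> l $ j\<close> unfolding t_def by (intro divide_nonneg_pos) auto
    then have "0 \<le> (\<Sum>i\<in>UNIV. v $ i \<bullet> (s0 - s0))
        + (\<Sum>i\<in>UNIV. l $ i * (F i s0 + 1 + (if i = j then t else 0)))"
      by (intro strict[OF \<open>s0 \<in> S\<close>]) auto
    also have "\<dots> = (\<Sum>i\<in>UNIV. l $ i * (F i s0 + 1) + (if i = j then l $ j * t else 0))"
      by (auto simp: distrib_left intro!: sum.cong)
    also have "\<dots> = A + l $ j * t"
      by (simp only: A_def sum.distrib) simp
    also have "l $ j * t = - \<bar>A\<bar> - 1"
      using \<open>\<not> 0 \<le> l $ j\<close> by (simp add: t_def field_simps)
    finally show False by linarith
  qed
  have "l \<noteq> 0"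
  proof
    assume "l = 0"
    have "0 \<le> (\<Sum>i\<in>UNIV. v $ i \<bullet> (- v $ i))"
      using main[OF \<open>s0 \<in> S\<close>, of "\<lambda>i. s0 - v $ i"] \<open>l = 0\<close> by simp
    then have "v \<bullet> v \<le> 0"
      by (simp add: inner_vec_def sum_negf)
    then have "v = 0"
      by (metis inner_gt_zero_iff not_less)
    with \<open>q \<noteq> 0\<close> \<open>l = 0\<close> show False
      by (simp add: vl zero_prod_def)
  qed
  show ?thesis
  proof
    show "semipositive l"
      using l_nonneg \<open>l \<noteq> 0\<close> by (simp add: semipositive_def)
    show "(\<Sum>i\<in>UNIV. - v $ i \<bullet> (y i - s)) \<le> (\<Sum>i\<in>UNIV. l $ i * F i (y i))" if "s \<in> S" for s y
      using main[OF that, of y] by (simp add: sum_negf)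
  qed
qed

text \<open>
  Specialising the copies: letting only one of them move away from the base point isolates a single
  scaled subgradient inequality, and letting none of them move leaves the optimality condition of
  the linearised problem.
\<close>

lemma subgradient_multipliers:
  fixes F :: "'p::finite \<Rightarrow> 'a::euclidean_space \<Rightarrow> real"
  assumes conv: "\<And>i. convex_on UNIV (F i)" and "convex S" and "x \<in> S"
    and zero: "\<And>i. F i x = 0" and nonneg: "\<And>s. s \<in> S \<Longrightarrow> \<exists>i. 0 \<le> F i s"
  obtains l :: "real ^ 'p" and a :: "'p \<Rightarrow> 'a"
  where "semipositive l" and "\<And>i y. a i \<bullet> (y - x) \<le> l $ i * F i y"
    and "\<And>s. s \<in> S \<Longrightarrow> 0 \<le> (\<Sum>i\<in>UNIV. a i \<bullet> (s - x))"
proof -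
  obtain l :: "real ^ 'p" and a where l: "semipositive l"
    and a: "\<And>s y. s \<in> S \<Longrightarrow> (\<Sum>i\<in>UNIV. a i \<bullet> (y i - s)) \<le> (\<Sum>i\<in>UNIV. l $ i * F i (y i))"
    using decoupled_multipliers[OF conv \<open>convex S\<close> _ nonneg] \<open>x \<in> S\<close> by blast
  have "a j \<bullet> (y - x) \<le> l $ j * F j y" for j y
  proof -
    have "(\<Sum>i\<in>UNIV. a i \<bullet> ((if i = j then y else x) - x)) = a j \<bullet> (y - x)"
      by (subst sum.mono_neutral_right[of _ "{j}"]) auto
    moreover have "(\<Sum>i\<in>UNIV. l $ i * F i (if i = j then y else x)) = l $ j * F j y"
      by (subst sum.mono_neutral_right[of _ "{j}"]) (auto simp: zero)
    ultimately show ?thesis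
      using a[OF \<open>x \<in> S\<close>, of "\<lambda>i. if i = j then y else x"] by simp
  qed
  moreover have "0 \<le> (\<Sum>i\<in>UNIV. a i \<bullet> (s - x))" if "s \<in> S" for s
    using a[OF that, of "\<lambda>_. x"]
    by (simp add: zero inner_diff_right sum_subtractf)
  ultimately show ?thesis
    using that l by blast
qed

text \<open>
  This is the multiplier rule over the singleton \<open>{x}\<close> for a family with the single
  member \<open>h - h x\<close>.
\<close>

lemma subdifferential_nonempty:
  fixes h :: "real ^ 'n \<Rightarrow> real"
  assumes "convex_on UNIV h"
  shows "subdifferential h x \<noteq> {}"
proof -
  have "convex_on UNIV (\<lambda>y. h y - h x)"
    using assms by (intro convex_on_diff) (auto simp: concave_on_const)
  then obtain l :: "real ^ unit" and a
    where l: "semipositive l" and a: "\<And>i y. a i \<bullet> (y - x) \<le> l $ i * (h y - h x)"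
    using subgradient_multipliers[of "\<lambda>_::unit. \<lambda>y. h y - h x" "{x}" x] by auto
  have "0 < l $ ()"
    using l by (auto simp: semipositive_def vec_eq_iff order_less_le)
  then have "h x + (a () /\<^sub>R l $ ()) \<bullet> (y - x) \<le> h y" for y
    using a[of "()" y] by (simp add: field_simps)
  then show ?thesis
    unfolding subdifferential_def by blast
qed

section \<open>Weighted sums, the gap function and the feasible set\<close>

lemma Max_ge_of_weighted_sum:
  fixes c :: "'p::finite \<Rightarrow> real" and l :: "real ^ 'p"
  assumes "semipositive l" and le: "(\<Sum>i\<in>UNIV. l $ i) * m \<le> (\<Sum>i\<in>UNIV. l $ i * c i)"
  shows "m \<le> (MAX i. c i)"
proof -
  have l: "0 \<le> l $ i" for i
    using assms(1) by (simp add: semipositive_def)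
  have "(\<Sum>i\<in>UNIV. l $ i) \<noteq> 0"
    using assms(1) by (auto simp: semipositive_def vec_eq_iff sum_nonneg_eq_0_iff)
  moreover have "0 \<le> (\<Sum>i\<in>UNIV. l $ i)"
    using l by (simp add: sum_nonneg)
  ultimately have pos: "0 < (\<Sum>i\<in>UNIV. l $ i)"
    by simp
  have "(\<Sum>i\<in>UNIV. l $ i * c i) \<le> (\<Sum>i\<in>UNIV. l $ i) * (MAX i. c i)"
    unfolding sum_distrib_right using l by (intro sum_mono mult_left_mono) auto
  with le have "(\<Sum>i\<in>UNIV. l $ i) * m \<le> (\<Sum>i\<in>UNIV. l $ i) * (MAX i. c i)"
    by linarith
  then show ?thesis
    using pos by simp
qed

lemma gap_function_eq_0_iff:
  assumes "x \<in> S"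
  shows "gap_function S x \<eta> l = 0 \<longleftrightarrow> (\<forall>y\<in>S. 0 \<le> (\<Sum>i\<in>UNIV. l $ i * (\<eta> $ i \<bullet> (y - x))))"
proof -
  define k where "k y = (\<Sum>i\<in>UNIV. l $ i * (\<eta> $ i \<bullet> (x - y)))" for y
  have gap: "gap_function S x \<eta> l = (SUP y\<in>S. ereal (k y))"
    by (simp add: gap_function_def k_def)
  have "k x = 0" by (simp add: k_def)
  then have "0 \<le> gap_function S x \<eta> l"
    unfolding gap using assms by (intro SUP_upper2[of x]) auto
  then have "gap_function S x \<eta> l = 0 \<longleftrightarrow> gap_function S x \<eta> l \<le> 0"
    by auto
  also have "\<dots> \<longleftrightarrow> (\<forall>y\<in>S. k y \<le> 0)"
    by (simp add: gap SUP_le_iff)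
  finally have "gap_function S x \<eta> l = 0 \<longleftrightarrow> (\<forall>y\<in>S. k y \<le> 0)" .
  moreover have "k y = - (\<Sum>i\<in>UNIV. l $ i * (\<eta> $ i \<bullet> (y - x)))" for y
    by (simp add: k_def inner_diff_right sum_negf[symmetric] algebra_simps)
  ultimately show ?thesis by simp
qed

lemma convex_feasible_set:
  assumes "\<And>t. t \<in> T \<Longrightarrow> convex_on UNIV (g t)"
  shows "convex (feasible_set T g)"
proof -
  have "feasible_set T g = (\<Inter>t\<in>T. {x. g t x \<le> 0})"
    by (auto simp: feasible_set_def)
  moreover have "convex {x. g t x \<le> 0}" if "t \<in> T" for t
  proof (rule convexI)
    fix x y and u v :: real
    assume xy: "x \<in> {x. g t x \<le> 0}" "y \<in> {x. g t x \<le> 0}"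
      and uv: "0 \<le> u" "0 \<le> v" "u + v = 1"
    have "g t (u *\<^sub>R x + v *\<^sub>R y) \<le> u * g t x + v * g t y"
      using assms[OF that] uv by (simp add: convex_on_def)
    also have "\<dots> \<le> 0"
      using xy uv by (simp add: add_nonpos_nonpos mult_nonneg_nonpos)
    finally show "u *\<^sub>R x + v *\<^sub>R y \<in> {x. g t x \<le> 0}" by simp
  qed
  ultimately show ?thesis
    by (simp add: convex_INT)
qed

section \<open>Isolated efficiency through tilted multipliers\<close>

lemma isolated_efficient_of_gap:
  fixes f :: "'p::finite \<Rightarrow> real ^ 'n \<Rightarrow> real"
  assumes "xh \<in> S" and "0 < \<nu>"
    and gap: "\<And>w. w \<in> cball 0 \<nu> \<Longrightarrow> \<exists>\<xi> l. (\<forall>i. \<xi> $ i \<in> subdifferential (f i) xh)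
      \<and> semipositive l \<and> gap_function S xh (\<chi> i. \<xi> $ i - w) l = 0"
  shows "isolated_efficient f S xh"
proof -
  have "\<nu> * norm (x - xh) \<le> (MAX i. f i x - f i xh)" if "x \<in> S" for x
  proof -
    \<comment> \<open>For \<open>x = xh\<close> the function \<open>sgn\<close> returns the zero vector, and both properties of \<open>w\<close> persist.\<close>
    define w where "w = \<nu> *\<^sub>R sgn (x - xh)"
    have "w \<in> cball 0 \<nu>"
      using \<open>0 < \<nu>\<close> by (simp add: w_def norm_sgn)
    moreover have w: "w \<bullet> (x - xh) = \<nu> * norm (x - xh)"
    proof -
      have "sgn (x - xh) \<bullet> (x - xh) = norm (x - xh)"
        by (cases "x = xh") (simp_all add: sgn_div_norm dot_square_norm power2_eq_square)
      then show ?thesis by (simp add: w_def)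
    qed
    ultimately obtain \<xi> l where \<xi>: "\<And>i. \<xi> $ i \<in> subdifferential (f i) xh"
      and l: "semipositive l" and "gap_function S xh (\<chi> i. \<xi> $ i - w) l = 0"
      using gap by blast
    then have "0 \<le> (\<Sum>i\<in>UNIV. l $ i * ((\<xi> $ i - w) \<bullet> (x - xh)))"
      using \<open>x \<in> S\<close> by (simp add: gap_function_eq_0_iff[OF \<open>xh \<in> S\<close>])
    then have "(\<Sum>i\<in>UNIV. l $ i) * (\<nu> * norm (x - xh)) \<le> (\<Sum>i\<in>UNIV. l $ i * (\<xi> $ i \<bullet> (x - xh)))"
      by (simp add: inner_diff_left w right_diff_distrib sum_subtractf sum_distrib_right)
    also have "\<dots> \<le> (\<Sum>i\<in>UNIV. l $ i * (f i x - f i xh))"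
    proof (intro sum_mono mult_left_mono)
      show "\<xi> $ i \<bullet> (x - xh) \<le> f i x - f i xh" for i
        using \<xi>[of i] by (auto simp: subdifferential_def algebra_simps)
      show "0 \<le> l $ i" for i
        using l by (simp add: semipositive_def)
    qed
    finally show ?thesis
      by (rule Max_ge_of_weighted_sum[OF l])
  qed
  then show ?thesis
    using \<open>xh \<in> S\<close> \<open>0 < \<nu>\<close> by (auto simp: isolated_efficient_def)
qed

text \<open>
  The multiplier rule is applied to the tilted increments. A positive weight can be divided out of
  the scaled subgradient; where the weight is zero, the scaled subgradient is bounded above as a
  linear form, hence zero, so that any subgradient of \<open>f i\<close> fits.
\<close>

lemma gap_of_isolated_efficient:
  fixes f :: "'p::finite \<Rightarrow> real ^ 'n \<Rightarrow> real"
  assumes conv: "\<And>i. convex_on UNIV (f i)" and "convex S" and "xh \<in> S"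
    and isolated: "\<And>x. x \<in> S \<Longrightarrow> \<nu> * norm (x - xh) \<le> (MAX i. f i x - f i xh)"
    and w: "norm w \<le> \<nu>"
  shows "\<exists>\<xi> l. (\<forall>i. \<xi> $ i \<in> subdifferential (f i) xh) \<and> semipositive l \<and>
    gap_function S xh (\<chi> i. \<xi> $ i - w) l = 0"
proof -
  define F where "F i x = f i x - f i xh - w \<bullet> (x - xh)" for i x
  have "convex_on UNIV (F i)" for i
  proof (rule convex_onI)
    fix t :: real and x y
    assume "0 < t" "t < 1"
    then show "F i ((1 - t) *\<^sub>R x + t *\<^sub>R y) \<le> (1 - t) * F i x + t * F i y"
      using convex_onD[OF conv[of i], of t x y]
      by (simp add: F_def inner_add_right inner_diff_right algebra_simps)
  qed simp
  moreover have "\<exists>i. 0 \<le> F i x" if "x \<in> S" for x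
  proof -
    have "(MAX i. f i x - f i xh) \<in> range (\<lambda>i. f i x - f i xh)"
      by (intro Max_in) auto
    then obtain i where "(MAX i. f i x - f i xh) = f i x - f i xh" by blast
    then have "\<nu> * norm (x - xh) \<le> f i x - f i xh"
      using isolated[OF that] by simp
    moreover have "w \<bullet> (x - xh) \<le> \<nu> * norm (x - xh)"
      using norm_cauchy_schwarz[of w "x - xh"] mult_right_mono[OF w, of "norm (x - xh)"] by simp
    ultimately have "0 \<le> F i x" by (simp add: F_def)
    then show ?thesis ..
  qed
  moreover have "F i xh = 0" for i by (simp add: F_def)
  ultimately obtain l :: "real ^ 'p" and a where l: "semipositive l"
    and a: "\<And>i y. a i \<bullet> (y - xh) \<le> l $ i * F i y"
    and opt: "\<And>s. s \<in> S \<Longrightarrow> 0 \<le> (\<Sum>i\<in>UNIV. a i \<bullet> (s - xh))"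
    using subgradient_multipliers[of F S xh] \<open>convex S\<close> \<open>xh \<in> S\<close> by blast
  have "\<exists>\<zeta>. \<zeta> \<in> subdifferential (f i) xh \<and> a i = l $ i *\<^sub>R (\<zeta> - w)" for i
  proof (cases "l $ i = 0")
    case True
    then have "a i \<bullet> a i \<le> 0"
      using a[of i "xh + a i"] by simp
    then have "a i = 0"
      by (metis inner_gt_zero_iff not_less)
    then show ?thesis
      using True subdifferential_nonempty[OF conv[of i]] by auto
  next
    case False
    then have pos: "0 < l $ i"
      using l by (simp add: semipositive_def order_less_le)
    let ?\<zeta> = "w + a i /\<^sub>R l $ i"
    have "f i xh + ?\<zeta> \<bullet> (y - xh) \<le> f i y" for y
    proof -
      have "(a i /\<^sub>R l $ i) \<bullet> (y - xh) \<le> F i y"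
        using a[of i y] pos by (simp add: field_simps)
      then show ?thesis
        by (simp add: F_def inner_add_left)
    qed
    moreover have "a i = l $ i *\<^sub>R (?\<zeta> - w)"
      using False by simp
    ultimately show ?thesis
      unfolding subdifferential_def by blast
  qed
  then obtain \<zeta> where \<zeta>: "\<And>i. \<zeta> i \<in> subdifferential (f i) xh" "\<And>i. a i = l $ i *\<^sub>R (\<zeta> i - w)"
    by metis
  have "gap_function S xh (\<chi> i. (\<chi> i. \<zeta> i) $ i - w) l = 0"
    using opt by (simp add: gap_function_eq_0_iff[OF \<open>xh \<in> S\<close>] \<zeta>(2))
  moreover have "(\<chi> i. \<zeta> i) $ i \<in> subdifferential (f i) xh" for i
    by (simp add: \<zeta>(1))
  ultimately show ?thesis
    using l by blast
qed

theorem theorem11: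
  fixes f :: "'p::finite \<Rightarrow> real ^ 'n \<Rightarrow> real"
    and X :: "'t topology"
    and g :: "'t \<Rightarrow> real ^ 'n \<Rightarrow> real"
    and xh :: "real ^ 'n"
  defines "S \<equiv> feasible_set (topspace X) g"
  assumes "CARD('p) \<ge> 2"
    and "\<And>i. convex_on UNIV (f i)"
    and "infinite (topspace X)"
    and "compact_space X" and "Hausdorff_space X"
    and "\<And>t. t \<in> topspace X \<Longrightarrow> convex_on UNIV (g t)"
    and "continuous_map (prod_topology X euclidean) euclidean (\<lambda>(t, x). g t x)"
    and "xh \<in> S"
    and "\<And>t. t \<in> topspace X \<Longrightarrow> continuously_differentiable_around (g t) xh"
    and "MFCQ (topspace X) g xh"
  shows "isolated_efficient f S xh \<longleftrightarrow>
    (\<exists>\<nu>>0. \<forall>w \<in> cball 0 \<nu>.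
       \<exists>\<xi> l. (\<forall>i. \<xi> $ i \<in> subdifferential (f i) xh) \<and> semipositive l \<and>
         gap_function S xh (\<chi> i. \<xi> $ i - w) l = 0)"
proof
  assume "isolated_efficient f S xh"
  then obtain \<nu> where "0 < \<nu>"
    and iso: "\<And>x. x \<in> S \<Longrightarrow> \<nu> * norm (x - xh) \<le> (MAX i. f i x - f i xh)"
    by (auto simp: isolated_efficient_def)
  have "convex S"
    unfolding S_def using assms(7) by (rule convex_feasible_set)
  have "\<exists>\<xi> l. (\<forall>i. \<xi> $ i \<in> subdifferential (f i) xh) \<and> semipositive l \<and>
      gap_function S xh (\<chi> i. \<xi> $ i - w) l = 0" if "w \<in> cball 0 \<nu>" for w
    using gap_of_isolated_efficient[OF assms(3) \<open>convex S\<close> \<open>xh \<in> S\<close> iso] that by simp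
  with \<open>0 < \<nu>\<close> show "\<exists>\<nu>>0. \<forall>w \<in> cball 0 \<nu>.
      \<exists>\<xi> l. (\<forall>i. \<xi> $ i \<in> subdifferential (f i) xh) \<and> semipositive l \<and>
        gap_function S xh (\<chi> i. \<xi> $ i - w) l = 0"
    by blast
next
  assume "\<exists>\<nu>>0. \<forall>w \<in> cball 0 \<nu>.
      \<exists>\<xi> l. (\<forall>i. \<xi> $ i \<in> subdifferential (f i) xh) \<and> semipositive l \<and>
        gap_function S xh (\<chi> i. \<xi> $ i - w) l = 0"
  then show "isolated_efficient f S xh"
    using isolated_efficient_of_gap[OF \<open>xh \<in> S\<close>] by blast
qed

end
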